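(* For $y\in X$ we have \begin{align*} A^*y^{\uparrow\downarrow}&=q^{-\dim y}y^{\uparrow\downarrow}-(q-1)q^{-2\dim y-1}\sum_{z\text{ covers }y}z^{\uparrow\downarrow},\\ A^+y^{\uparrow\downarrow}&=\frac{q^{\dim y}}{q-1}y^{\uparrow\downarrow},\\ A^-y^{\uparrow\downarrow}&=\frac{q^{N-\dim y}}{q-1}y^{\uparrow\downarrow}+q^{\dim y-1}\sum_{y\text{ covers }z}z^{\uparrow\downarrow},\\ Ay^{\uparrow\downarrow}&=\frac{\varphi q^{N-\dim y}-q^{\dim y}}{q-1}y^{\uparrow\downarrow}+\varphi q^{\dim y-1}\sum_{y\text{ covers }z}z^{\uparrow\downarrow}. \end{align*} Here the sums are over all $z\in X$ satisfying the indicated covering condition.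
   Context: Let $q$ be a prime power, $GF(q)$ the field with $q$ elements, $N\ge 1$ an integer, and $\mathbf V$ an $N$-dimensional vector space over $GF(q)$. Let $X$ be the set of all subspaces of $\mathbf V$, ordered by inclusion (the projective geometry $L_N(q)$). For $y,z\in X$, $y$ covers $z$ means $z\subseteq y$ and $\dim y-\dim z=1$. ${\rm Mat}_X(\mathbb C)$ is the algebra of complex matrices with rows and columns indexed by $X$; it acts on $V=\mathbb C^X$ by left multiplication. For $y\in X$, $\hat y\in V$ has $y$-coordinate $1$ and all other coordinates $0$. $A^*\in{\rm Mat}_X(\mathbb C)$ is the diagonal matrix with $(y,y)$-entry $q^{-\dim y}$. $R,L\in{\rm Mat}_X(\mathbb C)$: $R_{y,z}=1$ if $y$ covers $z$ and $0$ otherwise; $L_{y,z}=1$ if $z$ covers $y$ and $0$ otherwise. Fix a real number $\varphi>0$ and define \[ A=R+\varphi(A^* )^{-1}L+\frac{\varphi-1}{q-1}(A^* )^{-1},\quad A^+=\frac{(A^* )^{-1}}{q-1}-R,\quad A^-=\frac{(A^* )^{-1}}{q-1}+(A^* )^{-1}L . \] With $[n]_q=\frac{q^n-1}{q-1}$ and $[n]_q^!=[n]_q\cdots[1]_q$ ($[0]_q^!=1$), for nilpotent $\psi$ define $\exp_{q^{1/2}}(\psi)=\sum_{i\ge0}\frac{q^{i(i-1)/2}}{[i]_q^!}\psi^i$. For $y\in X$ define $y^{\uparrow\downarrow}=\exp_{q^{1/2}}(RA^* )\hat y$. *)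

theory Defs
  imports "HOL-Analysis.Analysis"
begin

(* [n]_q and [n]_q^! *)

definition qnum :: "real \<Rightarrow> nat \<Rightarrow> real" where
  "qnum q n = (q ^ n - 1) / (q - 1)"

definition qfact :: "real \<Rightarrow> nat \<Rightarrow> real" where
  "qfact q n = (\<Prod>i=1..n. qnum q i)"

definition mat_pow :: "complex^'x^'x \<Rightarrow> nat \<Rightarrow> complex^'x^'x" where
  "mat_pow M i = ((\<lambda>P. M ** P) ^^ i) (mat 1)"

(* exp_{q^(1/2)}; for nilpotent M only finitely many terms are nonzero.
   The division in the exponent is exact. *)

definition qexp :: "real \<Rightarrow> complex^'x^'x \<Rightarrow> complex^'x^'x" where
  "qexp q M = (\<Sum>i. (q ^ (i * (i - 1) div 2) / qfact q i) *\<^sub>R mat_pow M i)"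

(* The type 'v with scalar multiplication scale is the vector space over the
   finite field 'a.  The set X of its subspaces depends on scale, so it cannot be a
   type; in order to use the library's matrices, X is indexed by a finite type 'x through
   sub :: 'x => 'v set, which in use is a bijection onto the set of all subspaces. *)

context
  fixes scale :: "'a::{field,finite} \<Rightarrow> 'v::ab_group_add \<Rightarrow> 'v"
    and sub :: "'x::finite \<Rightarrow> 'v set"
begin

definition sdim :: "'x \<Rightarrow> nat" where
  "sdim y = vector_space.dim scale (sub y)"

definition covers :: "'x \<Rightarrow> 'x \<Rightarrow> bool" where
  "covers y z \<longleftrightarrow> sub z \<subseteq> sub y \<and> int (sdim y) - int (sdim z) = 1"

definition Astar :: "complex^'x^'x" where
  "Astar = (\<chi> y z. if y = z then of_real (real CARD('a) powi (- int (sdim y))) else 0)"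

definition Rmat :: "complex^'x^'x" where
  "Rmat = (\<chi> y z. if covers y z then 1 else 0)"

definition Lmat :: "complex^'x^'x" where
  "Lmat = (\<chi> y z. if covers z y then 1 else 0)"

definition Amat :: "real \<Rightarrow> complex^'x^'x" where
  "Amat \<phi> = Rmat + \<phi> *\<^sub>R (matrix_inv Astar ** Lmat)
             + ((\<phi> - 1) / (real CARD('a) - 1)) *\<^sub>R matrix_inv Astar"

definition Aplus :: "complex^'x^'x" where
  "Aplus = (1 / (real CARD('a) - 1)) *\<^sub>R matrix_inv Astar - Rmat"

definition Aminus :: "complex^'x^'x" where
  "Aminus = (1 / (real CARD('a) - 1)) *\<^sub>R matrix_inv Astar + matrix_inv Astar ** Lmat"

definition updown :: "'x \<Rightarrow> complex^'x" where
  "updown y = qexp (real CARD('a)) (Rmat ** Astar) *v axis y 1"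

end

end

theory Submission
  imports Defs
begin

text \<open>
  Applying \<open>R A*\<close> repeatedly to the basis vector of \<open>y\<close> counts weighted maximal chains above \<open>y\<close>,
  and there are \<open>[i]!\<close> of them up to a subspace of dimension \<open>dim y + i\<close>; hence the \<open>z\<close>-coordinate of
  \<open>updown y\<close> is \<open>q\<close> to the power \<open>- dim y (dim z - dim y)\<close> if \<open>y \<subseteq> z\<close>, and \<open>0\<close> otherwise. Each identity
  is then compared coordinatewise, and reduces to counting the covers of, or the subspaces
  covered by, one subspace that are comparable with another. The identity for \<open>A\<close> follows from
  \<open>A = \<phi> A\<^sup>- - A\<^sup>+\<close>.
\<close>

text \<open>For a set with only one possible member: its cardinality is then 1 or 0 according to the
  condition \<open>c\<close>.\<close>

lemma eq_if_singleton:
  assumes "\<And>x. x \<in> A \<Longrightarrow> x = a" "a \<in> A \<longleftrightarrow> c"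
  shows "A = (if c then {a} else {})"
  using assms by auto

section \<open>Counting subspaces of a finite vector space\<close>

text \<open>\<open>Basis\<close> only witnesses finite dimension; the dimension of the space is
  \<open>card Basis\<close>. The name \<open>q\<close> for the field size lets cardinalities be
  written as powers of \<open>q\<close>.\<close>

locale finite_field_space = finite_dimensional_vector_space scale Basis
  for scale :: "'a::{field,finite} \<Rightarrow> 'v::ab_group_add \<Rightarrow> 'v" and Basis +
  fixes q :: nat
  assumes card_field [simp]: "CARD('a) = q"
begin

lemma q_gt_1: "q > 1"
proof -
  have "card {0, 1::'a} \<le> CARD('a)"
    by (rule card_mono) auto
  then show ?thesis by simp
qed

text \<open>Permits cancelling q-numbers in the double count of flags and q-factorials in the
  exponential.\<close>

lemma qnum_neq_0:
  assumes "n > 0"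
  shows "qnum (real q) n \<noteq> 0"
proof -
  have "real q ^ n > 1"
    using q_gt_1 assms by (intro one_less_power) auto
  then show ?thesis
    unfolding qnum_def divide_eq_0_iff using q_gt_1 by linarith
qed

text \<open>Each new basis vector \<open>b\<close> multiplies the size by \<open>q\<close>, since
  every vector of the larger span is \<open>scale k b + s\<close> for exactly one pair
  \<open>(k, s)\<close>.\<close>

lemma card_span_independent:
  assumes "finite B" "independent B"
  shows "finite (span B) \<and> card (span B) = q ^ card B"
  using assms
proof (induction B rule: finite_induct)
  case empty
  then show ?case by simp
next
  case (insert b B)
  from insert.prems have ind: "independent B" and b: "b \<notin> span B"
    using insert.hyps independent_insert by auto
  let ?f = "\<lambda>(k, s). scale k b + s"
  have span: "span (insert b B) = ?f ` (UNIV \<times> span B)"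
  proof (intro set_eqI iffI)
    fix x assume "x \<in> span (insert b B)"
    then obtain k where "x - scale k b \<in> span B"
      by (auto simp: span_insert)
    then have "(k, x - scale k b) \<in> UNIV \<times> span B" "x = ?f (k, x - scale k b)"
      by auto
    then show "x \<in> ?f ` (UNIV \<times> span B)" by blast
  next
    fix x assume "x \<in> ?f ` (UNIV \<times> span B)"
    then obtain k s where "s \<in> span B" "x = scale k b + s"
      by auto
    then show "x \<in> span (insert b B)"
      by (auto simp: span_insert intro!: exI[of _ k])
  qed
  have inj: "inj_on ?f (UNIV \<times> span B)"
  proof (rule inj_onI, clarify)
    fix k s k' s' assume s: "s \<in> span B" "s' \<in> span B"
      and eq: "scale k b + s = scale k' b + s'"
    have "scale (k - k') b = s' - s"
      using eq by (simp add: scale_left_diff_distrib algebra_simps)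
    then have "scale (k - k') b \<in> span B"
      using s span_diff by simp
    \<comment> \<open>If \<open>k \<noteq> k'\<close>, scaling by the inverse of
      \<open>k - k'\<close> would put \<open>b\<close> into \<open>span B\<close>.\<close>
    then have "k = k'"
      using b span_scale[of "scale (k - k') b" B "inverse (k - k')"] by (cases "k = k'") auto
    then show "k = k' \<and> s = s'" using eq by simp
  qed
  show ?case
    using insert ind by (simp add: span card_image[OF inj] card_cartesian_product)
qed

text \<open>The type of vectors is not assumed finite; it is the span of a finite basis over a
  finite field.\<close>

lemma finite_space [simp]: "finite (A :: 'v set)"
  using card_span_independent[OF finite_Basis independent_Basis]
  by (auto simp: span_Basis intro: finite_subset[OF subset_UNIV])

lemma finite_space_sets [simp]: "finite (\<A> :: 'v set set)"
proof -
  have "finite (Pow (UNIV :: 'v set))" by (simp only: finite_Pow_iff finite_space)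
  then show ?thesis by (rule rev_finite_subset) simp
qed

lemma card_subspace:
  assumes "subspace S"
  shows "card S = q ^ dim S"
proof -
  obtain B where B: "B \<subseteq> S" "independent B" "S \<subseteq> span B" "card B = dim S"
    using basis_exists by blast
  then have "span B = S" using assms span_minimal by blast
  then show ?thesis
    using card_span_independent[of B] B by (simp add: finiteI_independent)
qed

lemma dim_span_insert:
  assumes "subspace U" "v \<notin> U"
  shows "dim (span (insert v U)) = Suc (dim U)"
  using assms by (simp add: dim_insert span_eq_iff[THEN iffD2])

text \<open>The differences \<open>S - U\<close> partition \<open>W - U\<close>, and all of them
  have the same size \<open>q ^ Suc (dim U) - q ^ dim U\<close>; dividing gives the count.\<close>

lemma card_atoms:
  assumes U: "subspace U" and W: "subspace W" and UW: "U \<subseteq> W"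
  shows "real (card {S. subspace S \<and> U \<subseteq> S \<and> S \<subseteq> W \<and> dim S = Suc (dim U)})
    = qnum (real q) (dim W - dim U)"
proof -
  define \<A> where "\<A> = {S. subspace S \<and> U \<subseteq> S \<and> S \<subseteq> W \<and> dim S = Suc (dim U)}"
  have le: "dim U \<le> dim W" using UW by (rule dim_subset)
  have A: "subspace S" "U \<subseteq> S" "S \<subseteq> W" "dim S = Suc (dim U)" if "S \<in> \<A>" for S
    using that by (auto simp: \<A>_def)
  \<comment> \<open>By dimension, one vector of \<open>S\<close> outside \<open>U\<close> already
    generates \<open>S\<close> over \<open>U\<close>; hence distinct members of \<open>\<A>\<close>
    meet only in \<open>U\<close>.\<close>
  have eq: "S = span (insert v U)" if "S \<in> \<A>" "v \<in> S - U" for S v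
  proof -
    have "span (insert v U) \<subseteq> S"
      using that A[of S] by (intro span_minimal) auto
    then show ?thesis
      using that A[of S] dim_span_insert[OF U, of v]
      by (intro subspace_dim_equal[symmetric]) (auto simp del: dim_span)
  qed
  have un: "W - U = (\<Union>S\<in>\<A>. S - U)"
  proof (intro equalityI subsetI)
    fix v assume v: "v \<in> W - U"
    have "span (insert v U) \<subseteq> W"
      using v W UW by (intro span_minimal) auto
    moreover have sup: "insert v U \<subseteq> span (insert v U)"
      by (rule span_superset)
    ultimately have "span (insert v U) \<in> \<A>"
      using v dim_span_insert[OF U, of v] unfolding \<A>_def by (auto simp del: dim_span)
    then show "v \<in> (\<Union>S\<in>\<A>. S - U)"
      using v sup by blast
  next
    fix v assume "v \<in> (\<Union>S\<in>\<A>. S - U)"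
    then show "v \<in> W - U" using A(3) by blast
  qed
  have disj: "(S - U) \<inter> (T - U) = {}" if "S \<in> \<A>" "T \<in> \<A>" "S \<noteq> T" for S T
    using that eq[of S] eq[of T] by (metis disjoint_iff)
  have "finite \<A>"
    by simp
  then have "card (W - U) = (\<Sum>S\<in>\<A>. card (S - U))"
    unfolding un using disj by (intro card_UN_disjoint) auto
  also have "\<dots> = (\<Sum>S\<in>\<A>. q ^ Suc (dim U) - q ^ dim U)"
  proof (rule sum.cong)
    fix S assume "S \<in> \<A>"
    then show "card (S - U) = q ^ Suc (dim U) - q ^ dim U"
      using U A[of S] by (simp add: card_Diff_subset card_subspace)
  qed simp
  finally have "q ^ dim W - q ^ dim U
      = card \<A> * (q ^ Suc (dim U) - q ^ dim U)"
    using U W UW by (simp add: card_Diff_subset card_subspace)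
  then have "real (q ^ dim W - q ^ dim U)
      = real (card \<A> * (q ^ Suc (dim U) - q ^ dim U))"
    by (rule arg_cong)
  then have "real q ^ dim W - real q ^ dim U = real (card \<A>) * (real q ^ Suc (dim U) - real q ^ dim U)"
    using le q_gt_1 by (simp add: of_nat_diff power_increasing)
  moreover have "real q ^ dim W = real q ^ dim U * real q ^ (dim W - dim U)"
    using le by (simp flip: power_add)
  ultimately have "real q ^ dim U * (real q ^ (dim W - dim U) - 1) = real q ^ dim U * (real (card \<A>) * (real q - 1))"
    by (simp add: algebra_simps)
  then have "real q ^ (dim W - dim U) - 1 = real (card \<A>) * (real q - 1)"
    using q_gt_1 by simp
  then show ?thesis
    using q_gt_1 by (simp add: qnum_def field_simps flip: \<A>_def)
qed

text \<open>Induction on the codimension, counting the flags \<open>U < S \<subseteq> H < W\<close> twice.\<close>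

lemma card_coatoms:
  assumes "subspace U" and W: "subspace W" and "U \<subseteq> W"
  shows "real (card {H. subspace H \<and> U \<subseteq> H \<and> H \<subseteq> W \<and> Suc (dim H) = dim W})
    = qnum (real q) (dim W - dim U)"
  using assms(1,3)
proof (induction "dim W - dim U" arbitrary: U)
  case 0
  then have "dim U = dim W" using dim_subset[of U W] by simp
  then have "\<not> (U \<subseteq> H \<and> Suc (dim H) = dim W)" for H
    using dim_subset[of U H] by auto
  then have "{H. subspace H \<and> U \<subseteq> H \<and> H \<subseteq> W \<and> Suc (dim H) = dim W} = {}"
    by blast
  then show ?case using 0 by (simp add: qnum_def)
next
  case (Suc n)
  show ?case
  \<comment> \<open>Codimension one is settled directly: the double count ends by cancelling
    \<open>qnum q n\<close>, which vanishes for \<open>n = 0\<close>.\<close>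
  proof (cases "n = 0")
    case True
    then have d: "Suc (dim U) = dim W" using Suc.hyps(2) by simp
    have "{H. subspace H \<and> U \<subseteq> H \<and> H \<subseteq> W \<and> Suc (dim H) = dim W} = {U}"
    proof (intro equalityI subsetI)
      fix H assume "H \<in> {H. subspace H \<and> U \<subseteq> H \<and> H \<subseteq> W \<and> Suc (dim H) = dim W}"
      then have "U = H"
        using Suc.prems d by (intro subspace_dim_equal) auto
      then show "H \<in> {U}" by simp
    qed (use Suc.prems d in auto)
    then show ?thesis
      using q_gt_1 Suc.hyps(2)[symmetric] by (simp add: qnum_def True)
  next
    case False
    define \<A> where "\<A> = {S. subspace S \<and> U \<subseteq> S \<and> S \<subseteq> W \<and> dim S = Suc (dim U)}"
    define \<H> where "\<H> = {H. subspace H \<and> U \<subseteq> H \<and> H \<subseteq> W \<and> Suc (dim H) = dim W}"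
    have "(\<Sum>H\<in>\<H>. \<Sum>S\<in>\<A>. if S \<subseteq> H then 1 else 0 :: real)
        = (\<Sum>S\<in>\<A>. \<Sum>H\<in>\<H>. if S \<subseteq> H then 1 else 0)"
      by (rule sum.swap)
    \<comment> \<open>Fixing \<open>H\<close> leaves an atom count inside \<open>H\<close>; fixing
      \<open>S\<close>, as done next, leaves the induction hypothesis with \<open>S\<close> in place
      of \<open>U\<close>. Either codimension is \<open>n\<close>, so the two totals share the
      factor \<open>qnum q n\<close>.\<close>
    moreover have "(\<Sum>S\<in>\<A>. if S \<subseteq> H then 1 else 0) = qnum (real q) n" if "H \<in> \<H>" for H
    proof -
      have "(\<Sum>S\<in>\<A>. if S \<subseteq> H then 1 else 0 :: real) = real (card {S \<in> \<A>. S \<subseteq> H})"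
        by (simp add: sum.If_cases Int_def)
      also have "{S \<in> \<A>. S \<subseteq> H} = {S. subspace S \<and> U \<subseteq> S \<and> S \<subseteq> H \<and> dim S = Suc (dim U)}"
        using that by (auto simp: \<A>_def \<H>_def)
      also have "real (card \<dots>) = qnum (real q) (dim H - dim U)"
        using that Suc.prems by (intro card_atoms) (auto simp: \<H>_def)
      also have "dim H - dim U = n"
        using that Suc.hyps(2) by (auto simp: \<H>_def)
      finally show ?thesis .
    qed
    moreover have "(\<Sum>H\<in>\<H>. if S \<subseteq> H then 1 else 0) = qnum (real q) n" if "S \<in> \<A>" for S
    proof -
      have n: "n = dim W - dim S"
        using that Suc.hyps(2) by (auto simp: \<A>_def)
      have "(\<Sum>H\<in>\<H>. if S \<subseteq> H then 1 else 0 :: real) = real (card {H \<in> \<H>. S \<subseteq> H})"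
        by (simp add: sum.If_cases Int_def)
      also have "{H \<in> \<H>. S \<subseteq> H} = {H. subspace H \<and> S \<subseteq> H \<and> H \<subseteq> W \<and> Suc (dim H) = dim W}"
        using that by (auto simp: \<A>_def \<H>_def)
      also have "real (card \<dots>) = qnum (real q) (dim W - dim S)"
        using that by (intro Suc.hyps(1)[OF n]) (auto simp: \<A>_def)
      finally show ?thesis by (simp add: n)
    qed
    ultimately have "real (card \<H>) * qnum (real q) n = real (card \<A>) * qnum (real q) n"
      by simp
    moreover have "qnum (real q) n \<noteq> 0"
      using False by (simp add: qnum_neq_0)
    ultimately have "real (card \<H>) = real (card \<A>)" by simp
    then show ?thesis
      using card_atoms[OF Suc.prems(1) W Suc.prems(2)] by (simp add: \<A>_def \<H>_def)
  qed
qed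

text \<open>The only candidate on the left is \<open>S \<inter> T\<close>, on the right \<open>S + T\<close>;
  both qualify under the same condition, by the modular law for dimensions.\<close>

lemma card_below_eq_card_above:
  assumes S: "subspace S" and T: "subspace T" and ST: "\<not> S \<subseteq> T"
  shows "card {X. subspace X \<and> X \<subseteq> S \<and> X \<subseteq> T \<and> dim S = Suc (dim X)}
    = card {W. subspace W \<and> S \<subseteq> W \<and> T \<subseteq> W \<and> dim W = Suc (dim T)}"
proof -
  let ?P = "{x + y |x y. x \<in> S \<and> y \<in> T}"
  have sub: "subspace (S \<inter> T)" "subspace ?P"
    using S T by (simp_all add: subspace_inter subspace_sums)
  have modular: "dim ?P + dim (S \<inter> T) = dim S + dim T"
    using S T by (rule dim_sums_Int)
  have P: "S \<subseteq> ?P" "T \<subseteq> ?P"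
    using subspace_0[OF S] subspace_0[OF T] by force+
  have least: "?P \<subseteq> W" if "subspace W" "S \<subseteq> W" "T \<subseteq> W" for W
    using that subspace_add by blast
  \<comment> \<open>Strictness makes the candidates unique: a hyperplane of \<open>S\<close> inside
    \<open>T\<close> has at least the dimension of \<open>S \<inter> T\<close>, and by the modular
    law \<open>?P\<close> has dimension at least \<open>Suc (dim T)\<close>.\<close>
  have int: "dim (S \<inter> T) < dim S"
    using ST S sub subspace_dim_equal[of "S \<inter> T" S] dim_subset[of "S \<inter> T" S]
    by (metis Int_lower1 Int_lower2 nat_less_le)
  have below: "X = S \<inter> T"
    if "subspace X" "X \<subseteq> S" "X \<subseteq> T" "dim S = Suc (dim X)" for X
    using that int sub by (intro subspace_dim_equal) auto
  have above: "W = ?P"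
    if "subspace W" "S \<subseteq> W" "T \<subseteq> W" "dim W = Suc (dim T)" for W
    using that int sub least modular by (intro subspace_dim_equal[symmetric]) auto
  define \<X> where "\<X> = {X. subspace X \<and> X \<subseteq> S \<and> X \<subseteq> T \<and> dim S = Suc (dim X)}"
  define \<W> where "\<W> = {W. subspace W \<and> S \<subseteq> W \<and> T \<subseteq> W \<and> dim W = Suc (dim T)}"
  have "X = S \<inter> T" if "X \<in> \<X>" for X
    using that below unfolding \<X>_def by simp
  moreover have "S \<inter> T \<in> \<X> \<longleftrightarrow> dim S = Suc (dim (S \<inter> T))"
    using sub(1) unfolding \<X>_def by simp
  ultimately have X: "\<X> = (if dim S = Suc (dim (S \<inter> T)) then {S \<inter> T} else {})"
    by (rule eq_if_singleton)
  have "W = ?P" if "W \<in> \<W>" for W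
    using that above unfolding \<W>_def mem_Collect_eq by blast
  moreover have "?P \<in> \<W> \<longleftrightarrow> dim ?P = Suc (dim T)"
    using sub(2) P unfolding \<W>_def mem_Collect_eq by blast
  ultimately have W: "\<W> = (if dim ?P = Suc (dim T) then {?P} else {})"
    by (rule eq_if_singleton)
  have "dim S = Suc (dim (S \<inter> T)) \<longleftrightarrow> dim ?P = Suc (dim T)"
    using modular by linarith
  then have "card \<X> = card \<W>"
    unfolding X W by simp
  then show ?thesis by (simp only: \<X>_def \<W>_def)
qed

end

section \<open>Matrices, axis vectors and q-factorials\<close>

text \<open>\<open>matrix_inv\<close> chooses some two-sided inverse, so uniqueness of inverses is
  what identifies it.\<close>

lemma matrix_inv_eqI:
  fixes A B :: "'a::semiring_1^'n^'n"
  assumes "A ** B = mat 1" "B ** A = mat 1"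
  shows "matrix_inv A = B"
  unfolding matrix_inv_def
proof (rule some_equality)
  fix C assume "A ** C = mat 1 \<and> C ** A = mat 1"
  then show "C = B"
    using assms by (metis matrix_mul_assoc matrix_mul_lid matrix_mul_rid)
qed (use assms in simp)

lemma sum_if_const:
  assumes "finite A"
  shows "(\<Sum>x\<in>A. if P x then c else 0 :: real) = real (card {x \<in> A. P x}) * c"
  using assms by (simp add: sum.If_cases Int_def)

text \<open>Scales an identity by \<open>c / p\<close> while keeping the summands apart, in the
  shape that \<open>Aminus_coef\<close> needs.\<close>

lemma divide_linear_combination:
  fixes a b x y z c p :: "'a::field"
  assumes "a + x * z = b + y * z"
  shows "a * c / p + x / p * (z * c) = b / p * c + y / p * (z * c)"
proof -
  have "a * c / p + x / p * (z * c) = (a + x * z) * c / p"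
    by (simp add: distrib_right add_divide_distrib)
  also have "\<dots> = b / p * c + y / p * (z * c)"
    by (simp add: assms distrib_right add_divide_distrib)
  finally show ?thesis .
qed

lemma mat_pow_Suc: "mat_pow M (Suc i) = M ** mat_pow M i"
  by (simp add: mat_pow_def)

lemma mat_pow_0: "mat_pow M 0 = mat 1"
  by (simp add: mat_pow_def)

lemma qfact_Suc: "qfact q (Suc i) = qfact q i * qnum q (Suc i)"
  by (simp add: qfact_def prod.nat_ivl_Suc')

text \<open>The increment \<open>i\<close> is the part of the weight exponent \<open>d y + i\<close>
  of one more chain step that does not depend on \<open>y\<close>.\<close>

lemma triangle_Suc: "Suc i * (Suc i - 1) div 2 = i * (i - 1) div 2 + (i :: nat)"
proof -
  have "Suc i * (Suc i - 1) = i * (i - 1) + i * 2"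
    by (cases i) (simp_all add: algebra_simps)
  then show ?thesis by simp
qed

lemma mult_axis_component: "(M *v axis y 1) $ z = M $ z $ y"
  for M :: "'a::semiring_1^'n^'m"
  by (simp add: matrix_vector_mult_def axis_def if_distrib[of "\<lambda>c. _ * c"] cong: if_cong)

lemma scaleR_matrix_vector_mult: "(c *\<^sub>R M) *v u = c *\<^sub>R (M *v u)"
  for M :: "'a::real_algebra_1^'n^'m"
  by (simp add: vec_eq_iff matrix_vector_mult_def scaleR_sum_right)

lemma scaleR_of_real: "c *\<^sub>R (of_real x :: complex) = of_real (c * x)"
  by (simp add: scaleR_conv_of_real)

section \<open>The subspace lattice indexed by a finite type\<close>

locale projective_geometry = finite_field_space scale Basis q
  for scale :: "'a::{field,finite} \<Rightarrow> 'v::ab_group_add \<Rightarrow> 'v" and Basis q +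
  fixes sub :: "'x::finite \<Rightarrow> 'v set"
  assumes bij_sub: "bij_betw sub UNIV {S. subspace S}"
begin

abbreviation d :: "'x \<Rightarrow> nat" where "d x \<equiv> dim (sub x)"
abbreviation cov :: "'x \<Rightarrow> 'x \<Rightarrow> bool" where "cov \<equiv> covers scale sub"
abbreviation R :: "complex^'x^'x" where "R \<equiv> Rmat scale sub"
abbreviation L :: "complex^'x^'x" where "L \<equiv> Lmat scale sub"
abbreviation AS :: "complex^'x^'x" where "AS \<equiv> Astar scale sub"
abbreviation ud :: "'x \<Rightarrow> complex^'x" where "ud \<equiv> updown scale sub"

lemma subspace_sub [simp]: "subspace (sub x)"
  using bij_sub by (auto simp: bij_betw_def)

lemma covers_iff: "cov y z \<longleftrightarrow> sub z \<subseteq> sub y \<and> d y = Suc (d z)"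
  by (auto simp: covers_def sdim_def)

lemma d_le: "d x \<le> card Basis"
  using dim_subset_UNIV[of "sub x"] by (simp add: dimension_def)

lemma d_mono: "sub x \<subseteq> sub y \<Longrightarrow> d x \<le> d y"
  by (rule dim_subset)

text \<open>As \<open>sub\<close> is a bijection onto the subspaces, the counts proved above carry
  over to indices.\<close>

lemma card_Collect_sub: "card {x. P (sub x)} = card {S. subspace S \<and> P S}"
proof -
  have "inj_on sub {x. P (sub x)}"
    using bij_sub by (meson bij_betw_imp_inj_on inj_on_subset subset_UNIV)
  moreover have "sub ` {x. P (sub x)} = {S. subspace S \<and> P S}"
  proof (intro equalityI subsetI)
    fix S assume S: "S \<in> {S. subspace S \<and> P S}"
    then obtain x where "S = sub x"
      using bij_sub by (auto simp: bij_betw_def image_iff)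
    then show "S \<in> sub ` {x. P (sub x)}" using S by auto
  qed auto
  ultimately show ?thesis by (metis card_image)
qed

lemma card_covers_between:
  assumes "sub y \<subseteq> sub z"
  shows "real (card {w. cov w y \<and> sub w \<subseteq> sub z}) = qnum (real q) (d z - d y)"
proof -
  have "card {w. cov w y \<and> sub w \<subseteq> sub z}
      = card {S. subspace S \<and> sub y \<subseteq> S \<and> S \<subseteq> sub z \<and> dim S = Suc (d y)}"
    unfolding covers_iff by (subst card_Collect_sub[symmetric]) (simp only: conj_ac)
  then show ?thesis using card_atoms[of "sub y" "sub z"] assms by simp
qed

lemma card_covered_between:
  assumes "sub y \<subseteq> sub z"
  shows "real (card {w. cov z w \<and> sub y \<subseteq> sub w}) = qnum (real q) (d z - d y)"
proof -
  have "card {w. cov z w \<and> sub y \<subseteq> sub w}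
      = card {S. subspace S \<and> sub y \<subseteq> S \<and> S \<subseteq> sub z \<and> Suc (dim S) = d z}"
    unfolding covers_iff by (subst card_Collect_sub[symmetric]) (simp only: conj_ac eq_commute)
  then show ?thesis using card_coatoms[of "sub y" "sub z"] assms by simp
qed

text \<open>The whole space serves as upper end of the interval, so \<open>card Basis\<close> enters
  as its dimension.\<close>

lemma card_covers: "real (card {w. cov w z}) = qnum (real q) (card Basis - d z)"
proof -
  have "card {w. cov w z}
      = card {S. subspace S \<and> sub z \<subseteq> S \<and> S \<subseteq> UNIV \<and> dim S = Suc (d z)}"
    unfolding covers_iff by (subst card_Collect_sub[symmetric]) simp
  then show ?thesis using card_atoms[of "sub z" UNIV] by simp
qed

text \<open>The zero subspace serves as lower end of the interval.\<close>

lemma card_covered: "real (card {w. cov y w}) = qnum (real q) (d y)"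
proof -
  have "card {w. cov y w}
      = card {S. subspace S \<and> {0} \<subseteq> S \<and> S \<subseteq> sub y \<and> Suc (dim S) = d y}"
    unfolding covers_iff
    by (subst card_Collect_sub[symmetric]) (auto simp: subspace_0 intro!: arg_cong[where f = card])
  then show ?thesis using card_coatoms[of "{0}" "sub y"] by (simp add: subspace_0)
qed

lemma card_covered_eq_card_covers:
  assumes "\<not> sub y \<subseteq> sub z"
  shows "card {w. cov y w \<and> sub w \<subseteq> sub z} = card {w. cov w z \<and> sub y \<subseteq> sub w}"
proof -
  have "card {w. cov y w \<and> sub w \<subseteq> sub z}
      = card {X. subspace X \<and> X \<subseteq> sub y \<and> X \<subseteq> sub z \<and> d y = Suc (dim X)}"
    unfolding covers_iff by (subst card_Collect_sub[symmetric]) (simp only: conj_ac)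
  also have "\<dots> = card {W. subspace W \<and> sub y \<subseteq> W \<and> sub z \<subseteq> W \<and> dim W = Suc (d z)}"
    using assms by (intro card_below_eq_card_above) auto
  also have "\<dots> = card {w. cov w z \<and> sub y \<subseteq> sub w}"
    unfolding covers_iff by (subst card_Collect_sub[symmetric]) (simp only: conj_ac)
  finally show ?thesis .
qed

section \<open>Action of the matrices on coordinates\<close>

lemma Rmat_mult: "(R *v u) $ z = (\<Sum>w\<in>{w. cov z w}. u $ w)"
  by (simp add: Rmat_def matrix_vector_mult_def sum.inter_filter[symmetric] if_distrib[of "\<lambda>c. c * _"] cong: if_cong)

lemma Lmat_mult: "(L *v u) $ z = (\<Sum>w\<in>{w. cov w z}. u $ w)"
  by (simp add: Lmat_def matrix_vector_mult_def sum.inter_filter[symmetric] if_distrib[of "\<lambda>c. c * _"] cong: if_cong)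

lemma Astar_mult: "(AS *v u) $ z = of_real (real q powi (- int (d z))) * u $ z"
  by (simp add: Astar_def sdim_def matrix_vector_mult_def if_distrib[of "\<lambda>c. c * _"] cong: if_cong)

lemma matrix_inv_Astar:
  "matrix_inv AS = (\<chi> y z. if y = z then of_real (real q ^ d y) else 0)"
  using q_gt_1
  by (intro matrix_inv_eqI)
    (simp_all add: Astar_def sdim_def matrix_matrix_mult_def mat_def vec_eq_iff power_int_minus
      if_distrib[of "\<lambda>c. c * _"] if_distrib[of "\<lambda>c. _ * c"] cong: if_cong)

lemma matrix_inv_Astar_mult: "(matrix_inv AS *v u) $ z = of_real (real q ^ d z) * u $ z"
  by (simp add: matrix_inv_Astar matrix_vector_mult_def if_distrib[of "\<lambda>c. c * _"] cong: if_cong)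

section \<open>Coordinates of the vectors \<open>updown y\<close>\<close>

text \<open>Induction on the last link of a chain: the subspaces covered by \<open>z\<close> and
  containing \<open>y\<close> number \<open>qnum q (i + 1)\<close>, which extends the q-factorial,
  and each has weight \<open>1 / q ^ (d y + i)\<close>, which extends the denominator.\<close>

lemma mat_pow_RA_axis:
  "(mat_pow (R ** AS) i *v axis y 1) $ z = of_real
    (if sub y \<subseteq> sub z \<and> d z = d y + i
     then qfact (real q) i / (real q ^ (i * d y) * real q ^ (i * (i - 1) div 2)) else 0)"
proof (induction i arbitrary: z)
  case 0
  have "sub y \<subseteq> sub z \<and> d z = d y \<longleftrightarrow> z = y"
    using bij_sub subspace_dim_equal[of "sub y" "sub z"]
    by (auto simp: bij_betw_def dest: injD)
  then show ?case by (simp add: mat_pow_0 axis_def qfact_def)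
next
  case (Suc i)
  let ?c = "qfact (real q) i / (real q ^ (i * d y) * real q ^ (i * (i - 1) div 2))"
  have "(mat_pow (R ** AS) (Suc i) *v axis y 1) $ z
      = (R *v (AS *v (mat_pow (R ** AS) i *v axis y 1))) $ z"
    by (simp add: mat_pow_Suc matrix_vector_mul_assoc matrix_mul_assoc)
  also have "\<dots> = of_real (\<Sum>w\<in>{w. cov z w}. real q powi (- int (d w)) *
      (if sub y \<subseteq> sub w \<and> d w = d y + i then ?c else 0))"
    by (simp only: Rmat_mult Astar_mult Suc.IH of_real_sum of_real_mult)
  also have "(\<Sum>w\<in>{w. cov z w}. real q powi (- int (d w)) *
      (if sub y \<subseteq> sub w \<and> d w = d y + i then ?c else 0))
    = (\<Sum>w\<in>{w. cov z w}. if sub y \<subseteq> sub w \<and> d w = d y + i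
        then ?c / real q ^ (d y + i) else 0)"
    by (intro sum.cong) (auto simp: power_int_minus field_simps)
  also have "\<dots> = real (card {w. cov z w \<and> sub y \<subseteq> sub w \<and> d w = d y + i})
      * (?c / real q ^ (d y + i))"
    by (simp add: sum_if_const)
  also have "\<dots> = (if sub y \<subseteq> sub z \<and> d z = d y + Suc i
     then qfact (real q) (Suc i) / (real q ^ (Suc i * d y) * real q ^ (Suc i * (Suc i - 1) div 2)) else 0)"
  proof (cases "sub y \<subseteq> sub z \<and> d z = d y + Suc i")
    case True
    \<comment> \<open>Being covered by \<open>z\<close> already forces the dimension
      \<open>d y + i\<close>.\<close>
    then have "{w. cov z w \<and> sub y \<subseteq> sub w \<and> d w = d y + i} = {w. cov z w \<and> sub y \<subseteq> sub w}"
      by (auto simp: covers_iff)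
    then show ?thesis
      using True card_covered_between[of y z]
      by (simp only: qfact_Suc triangle_Suc) (simp add: power_add mult_ac)
  next
    case False
    then have "{w. cov z w \<and> sub y \<subseteq> sub w \<and> d w = d y + i} = {}"
      by (auto simp: covers_iff)
    then show ?thesis
      using False by (simp only: if_False card.empty of_nat_0 mult_zero_left)
  qed
  finally show ?case .
qed

text \<open>Integer exponents keep the formula valid under the shifts of either dimension by one
  that sums over covers produce; natural subtraction would truncate.\<close>

definition coef :: "'x \<Rightarrow> 'x \<Rightarrow> real" where
  "coef y z = (if sub y \<subseteq> sub z then real q powi (- (int (d y) * (int (d z) - int (d y)))) else 0)"

text \<open>Only the term \<open>i = d z - d y\<close> reaches \<open>z\<close>. Its q-factorial and
  its triangular power of \<open>q\<close> cancel against the coefficient of the exponential,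
  leaving \<open>1 / q ^ (i * d y)\<close>.\<close>

lemma updown_component: "ud y $ z = of_real (coef y z)"
proof -
  let ?a = "\<lambda>i. real q ^ (i * (i - 1) div 2) / qfact (real q) i"
  have entry: "mat_pow (R ** AS) i $ z $ x = (mat_pow (R ** AS) i *v axis x 1) $ z" for i z x
    by (simp add: mult_axis_component)
  \<comment> \<open>Every factor raises the dimension by one and no dimension exceeds
    \<open>card Basis\<close>, so the series is a finite sum.\<close>
  have "mat_pow (R ** AS) i = 0" if "i \<notin> {..card Basis}" for i
  proof -
    have "d z \<noteq> d x + i" for x z
      using that d_le[of z] by simp
    then show ?thesis by (simp add: vec_eq_iff entry mat_pow_RA_axis)
  qed
  then have "qexp (real q) (R ** AS) = (\<Sum>i\<le>card Basis. ?a i *\<^sub>R mat_pow (R ** AS) i)"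
    unfolding qexp_def by (intro suminf_finite) simp_all
  then have "ud y $ z = (\<Sum>i\<le>card Basis. ?a i *\<^sub>R (mat_pow (R ** AS) i *v axis y 1) $ z)"
    by (simp add: updown_def mult_axis_component)
  also have "\<dots> = of_real (\<Sum>i\<le>card Basis. ?a i * 
     (if sub y \<subseteq> sub z \<and> d z = d y + i
     then qfact (real q) i / (real q ^ (i * d y) * real q ^ (i * (i - 1) div 2)) else 0))"
    by (simp only: mat_pow_RA_axis scaleR_conv_of_real of_real_sum of_real_mult)
  \<comment> \<open>Truncation in \<open>d z - d y\<close> is harmless: if \<open>d z < d y\<close>,
    then \<open>y\<close> is not contained in \<open>z\<close> and \<open>coef y z\<close> is
    0.\<close>
  also have "(\<Sum>i\<le>card Basis. ?a i * 
     (if sub y \<subseteq> sub z \<and> d z = d y + i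
     then qfact (real q) i / (real q ^ (i * d y) * real q ^ (i * (i - 1) div 2)) else 0))
     = (\<Sum>i\<le>card Basis. if i = d z - d y then coef y z else 0)"
  proof (rule sum.cong)
    fix i
    have "qfact (real q) i \<noteq> 0"
      by (simp add: qfact_def qnum_neq_0)
    then show "?a i * (if sub y \<subseteq> sub z \<and> d z = d y + i
        then qfact (real q) i / (real q ^ (i * d y) * real q ^ (i * (i - 1) div 2)) else 0)
      = (if i = d z - d y then coef y z else 0)"
      using q_gt_1 d_mono[of y z]
      by (auto simp: coef_def power_int_minus field_simps power_int_of_nat simp flip: of_nat_mult)
  qed simp
  also have "\<dots> = coef y z"
    using d_le[of z] by simp
  finally show ?thesis .
qed

section \<open>Sums of coefficients over covering relations\<close>

lemma q_neq_0: "real q \<noteq> 0"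
  using q_gt_1 by simp

text \<open>Passes to integer exponents, whose addition law needs no order condition.\<close>

lemma qnum_diff:
  assumes "m \<le> n"
  shows "qnum (real q) (n - m) = (real q powi (int n - int m) - 1) / (real q - 1)"
  using assms by (simp add: qnum_def flip: of_nat_diff)

text \<open>Every nonzero summand is the same, because \<open>w\<close> has dimension
  \<open>d z - 1\<close>; the hyperplanes of \<open>z\<close> containing \<open>y\<close> are then
  counted.\<close>

lemma sum_coef_covered:
  "(\<Sum>w\<in>{w. cov z w}. coef y w) = (if sub y \<subseteq> sub z
     then qnum (real q) (d z - d y) * real q powi (- (int (d y) * (int (d z) - 1 - int (d y)))) else 0)"
proof -
  let ?c = "real q powi (- (int (d y) * (int (d z) - 1 - int (d y))))"
  have "(\<Sum>w\<in>{w. cov z w}. coef y w) = (\<Sum>w\<in>{w. cov z w}. if sub y \<subseteq> sub w then ?c else 0)"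
    by (intro sum.cong) (auto simp: coef_def covers_iff)
  also have "\<dots> = real (card {w. cov z w \<and> sub y \<subseteq> sub w}) * ?c"
    by (simp add: sum_if_const)
  also have "\<dots> = (if sub y \<subseteq> sub z then qnum (real q) (d z - d y) * ?c else 0)"
  proof (cases "sub y \<subseteq> sub z")
    case False
    then have "{w. cov z w \<and> sub y \<subseteq> sub w} = {}" by (auto simp: covers_iff)
    then show ?thesis using False by simp
  qed (simp add: card_covered_between)
  finally show ?thesis .
qed

text \<open>Here the first index varies: \<open>w\<close> has dimension \<open>d y + 1\<close>, and
  the relevant \<open>w\<close> are the atoms of the interval from \<open>y\<close> to
  \<open>z\<close>.\<close>

lemma sum_covers_coef:
  "(\<Sum>w\<in>{w. cov w y}. coef w z) = (if sub y \<subseteq> sub z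
     then qnum (real q) (d z - d y) * real q powi (- ((int (d y) + 1) * (int (d z) - int (d y) - 1))) else 0)"
proof -
  let ?c = "real q powi (- ((int (d y) + 1) * (int (d z) - int (d y) - 1)))"
  have "(\<Sum>w\<in>{w. cov w y}. coef w z) = (\<Sum>w\<in>{w. cov w y}. if sub w \<subseteq> sub z then ?c else 0)"
    by (intro sum.cong) (auto simp: coef_def covers_iff algebra_simps)
  also have "\<dots> = real (card {w. cov w y \<and> sub w \<subseteq> sub z}) * ?c"
    by (simp add: sum_if_const)
  also have "\<dots> = (if sub y \<subseteq> sub z then qnum (real q) (d z - d y) * ?c else 0)"
  proof (cases "sub y \<subseteq> sub z")
    case False
    then have "{w. cov w y \<and> sub w \<subseteq> sub z} = {}" by (auto simp: covers_iff)
    then show ?thesis using False by simp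
  qed (simp add: card_covers_between)
  finally show ?thesis .
qed

text \<open>The cardinality stays unevaluated, since a cover of \<open>z\<close> may contain
  \<open>y\<close> although \<open>z\<close> does not.\<close>

lemma sum_coef_covers:
  "(\<Sum>w\<in>{w. cov w z}. coef y w) = real (card {w. cov w z \<and> sub y \<subseteq> sub w})
     * real q powi (- (int (d y) * (int (d z) + 1 - int (d y))))"
proof -
  have "(\<Sum>w\<in>{w. cov w z}. coef y w) = (\<Sum>w\<in>{w. cov w z}. if sub y \<subseteq> sub w
      then real q powi (- (int (d y) * (int (d z) + 1 - int (d y)))) else 0)"
    by (intro sum.cong) (auto simp: coef_def covers_iff algebra_simps)
  then show ?thesis by (simp add: sum_if_const)
qed

text \<open>Again the count stays open, since \<open>z\<close> may contain a hyperplane of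
  \<open>y\<close> without containing \<open>y\<close>. For \<open>d y = 0\<close> nothing is
  covered, so the negative \<open>int (d y) - 1\<close> does no harm.\<close>

lemma sum_covered_coef:
  "(\<Sum>w\<in>{w. cov y w}. coef w z) = real (card {w. cov y w \<and> sub w \<subseteq> sub z})
     * real q powi (- ((int (d y) - 1) * (int (d z) - int (d y) + 1)))"
proof -
  have "(\<Sum>w\<in>{w. cov y w}. coef w z) = (\<Sum>w\<in>{w. cov y w}. if sub w \<subseteq> sub z
      then real q powi (- ((int (d y) - 1) * (int (d z) - int (d y) + 1))) else 0)"
    by (intro sum.cong) (auto simp: coef_def covers_iff algebra_simps)
  then show ?thesis by (simp add: sum_if_const)
qed

section \<open>The identities coordinate by coordinate\<close>

text \<open>The factor \<open>q - 1\<close> clears the denominator of \<open>qnum\<close>, leaving a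
  difference of two powers of \<open>q\<close>, which are the two multiples of
  \<open>coef y z\<close>. Without containment everything vanishes.\<close>

lemma Astar_coef:
  "real q powi (- int (d z)) * coef y z = real q powi (- int (d y)) * coef y z
     - (real q - 1) * real q powi (- 2 * int (d y) - 1) * (\<Sum>w\<in>{w. cov w y}. coef w z)"
proof (cases "sub y \<subseteq> sub z")
  case True
  let ?Q = "\<lambda>i. real q powi i"
  let ?e = "int (d y)" and ?d = "int (d z)"
  have "(real q - 1) * ?Q (- 2 * ?e - 1) * (\<Sum>w\<in>{w. cov w y}. coef w z)
      = (?Q (?d - ?e) - 1) * ?Q (- 2 * ?e - 1) * ?Q (- ((?e + 1) * (?d - ?e - 1)))"
    using True q_gt_1 by (simp add: sum_covers_coef qnum_diff d_mono)
  also have "\<dots> = ?Q ((?d - ?e) + (- 2 * ?e - 1) + (- ((?e + 1) * (?d - ?e - 1))))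
      - ?Q ((- 2 * ?e - 1) + (- ((?e + 1) * (?d - ?e - 1))))"
    using q_neq_0 by (simp only: power_int_add simp_thms) (simp add: algebra_simps)
  also have "(?d - ?e) + (- 2 * ?e - 1) + (- ((?e + 1) * (?d - ?e - 1))) = - ?e + (- (?e * (?d - ?e)))"
    by (simp add: algebra_simps)
  also have "(- 2 * ?e - 1) + (- ((?e + 1) * (?d - ?e - 1))) = - ?d + (- (?e * (?d - ?e)))"
    by (simp add: algebra_simps)
  finally show ?thesis
    using True q_neq_0 by (simp only: power_int_add simp_thms coef_def if_True)
qed (simp add: sum_covers_coef, simp add: coef_def)

text \<open>Lowering the dimension of \<open>z\<close> by one multiplies the coefficient by
  \<open>q ^ d y\<close>; the numerator of \<open>qnum\<close> then cancels the term with
  \<open>q ^ d z\<close>.\<close>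

lemma Aplus_coef:
  "real q ^ d z * coef y z / (real q - 1) - (\<Sum>w\<in>{w. cov z w}. coef y w)
    = real q ^ d y / (real q - 1) * coef y z"
proof (cases "sub y \<subseteq> sub z")
  case True
  let ?Q = "\<lambda>i. real q powi i"
  let ?e = "int (d y)" and ?d = "int (d z)"
  have "- (?e * (?d - 1 - ?e)) = ?e + (- (?e * (?d - ?e)))"
    by (simp add: algebra_simps)
  moreover have "coef y z = ?Q (- (?e * (?d - ?e)))"
    using True by (simp add: coef_def)
  ultimately have "?Q (- (?e * (?d - 1 - ?e))) = ?Q ?e * coef y z"
    using q_neq_0 by (metis power_int_add)
  then have "(\<Sum>w\<in>{w. cov z w}. coef y w) = (?Q (?d - ?e) - 1) / (real q - 1) * (?Q ?e * coef y z)"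
    using True by (simp add: sum_coef_covered qnum_diff d_mono)
  also have "\<dots> = (?Q (?d - ?e + ?e) - ?Q ?e) / (real q - 1) * coef y z"
    using q_neq_0 by (simp only: power_int_add simp_thms) (simp add: algebra_simps diff_divide_distrib)
  finally show ?thesis by (simp add: algebra_simps diff_divide_distrib)
qed (simp add: sum_coef_covered, simp add: coef_def)

text \<open>After scaling, both sums are a cardinality times one common weight. The cardinalities
  agree if \<open>y\<close> is not contained in \<open>z\<close>, and are explicit q-numbers
  otherwise.\<close>

lemma Aminus_coef:
  "real q ^ d z * coef y z / (real q - 1) + real q ^ d z * (\<Sum>w\<in>{w. cov w z}. coef y w)
    = real q powi (int (card Basis) - int (d y)) / (real q - 1) * coef y z
      + real q powi (int (d y) - 1) * (\<Sum>w\<in>{w. cov y w}. coef w z)"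
proof -
  let ?Q = "\<lambda>i. real q powi i"
  let ?e = "int (d y)" and ?d = "int (d z)" and ?N = "int (card Basis)"
  \<comment> \<open>This is \<open>coef y z\<close> only when \<open>y\<close> is contained in
    \<open>z\<close>; the weights \<open>1\<close> and \<open>2\<close> below hold in either
    case.\<close>
  let ?c = "?Q (- (?e * (?d - ?e)))"
  have "?d + (- (?e * (?d + 1 - ?e))) = (?d - ?e) + (- (?e * (?d - ?e)))"
    by (simp add: algebra_simps)
  then have "?Q ?d * ?Q (- (?e * (?d + 1 - ?e))) = ?Q (?d - ?e) * ?c"
    using q_neq_0 by (metis power_int_add)
  note E = this[unfolded power_int_of_nat]
  have 1: "real q ^ d z * (\<Sum>w\<in>{w. cov w z}. coef y w)
      = real (card {w. cov w z \<and> sub y \<subseteq> sub w}) * (?Q (?d - ?e) * ?c)"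
    unfolding sum_coef_covers E[symmetric] by (simp only: mult_ac)
  have "(?e - 1) + (- ((?e - 1) * (?d - ?e + 1))) = (?d - ?e) + (- (?e * (?d - ?e)))"
    by (simp add: algebra_simps)
  then have E: "?Q (?e - 1) * ?Q (- ((?e - 1) * (?d - ?e + 1))) = ?Q (?d - ?e) * ?c"
    using q_neq_0 by (metis power_int_add)
  have 2: "?Q (?e - 1) * (\<Sum>w\<in>{w. cov y w}. coef w z)
      = real (card {w. cov y w \<and> sub w \<subseteq> sub z}) * (?Q (?d - ?e) * ?c)"
    unfolding sum_covered_coef E[symmetric] by (simp only: mult_ac)
  show ?thesis
  proof (cases "sub y \<subseteq> sub z")
    case True
    have "{w. cov w z \<and> sub y \<subseteq> sub w} = {w. cov w z}"
      "{w. cov y w \<and> sub w \<subseteq> sub z} = {w. cov y w}"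
      using True by (auto simp: covers_iff)
    then have
      "real (card {w. cov w z \<and> sub y \<subseteq> sub w}) = (?Q (?N - ?d) - 1) / (real q - 1)"
      "real (card {w. cov y w \<and> sub w \<subseteq> sub z}) = (?Q ?e - 1) / (real q - 1)"
      using d_le[of z] by (simp_all add: card_covers card_covered qnum_diff) (simp add: qnum_def)
    \<comment> \<open>Both sides expand to
      \<open>?Q ?d + ?Q (?N - ?e) - ?Q (?d - ?e)\<close>.\<close>
    moreover
    have "?Q ?d + (?Q (?N - ?d) - 1) * ?Q (?d - ?e) = ?Q (?N - ?e) + (?Q ?e - 1) * ?Q (?d - ?e)"
    proof -
      have "?Q (?N - ?d) * ?Q (?d - ?e) = ?Q (?N - ?e)" "?Q ?e * ?Q (?d - ?e) = ?Q ?d"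
        using power_int_add[of "real q" "?N - ?d" "?d - ?e"] power_int_add[of "real q" ?e "?d - ?e"] q_neq_0
        by simp_all
      then show ?thesis by (simp add: algebra_simps)
    qed
    then have "?Q ?d * ?c / (real q - 1) + (?Q (?N - ?d) - 1) / (real q - 1) * (?Q (?d - ?e) * ?c)
        = ?Q (?N - ?e) / (real q - 1) * ?c + (?Q ?e - 1) / (real q - 1) * (?Q (?d - ?e) * ?c)"
      by (rule divide_linear_combination)
    ultimately show ?thesis
      unfolding 1 2 using True by (simp only: coef_def if_True power_int_of_nat)
  next
    case False
    then show ?thesis
      unfolding 1 2 by (simp add: coef_def card_covered_eq_card_covers)
  qed
qed

section \<open>From coordinates back to vectors\<close>

text \<open>All coordinates are real, so moving \<open>of_real\<close> outward reduces each equation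
  to the matching identity for \<open>coef\<close>.\<close>

lemma updown_identities:
  "AS *v ud y = (real q powi (- int (d y))) *\<^sub>R ud y
     - ((real q - 1) * real q powi (- 2 * int (d y) - 1)) *\<^sub>R (\<Sum>z\<in>{z. cov z y}. ud z)" (is ?star)
  "Aplus scale sub *v ud y = (real q ^ d y / (real q - 1)) *\<^sub>R ud y" (is ?plus)
  "Aminus scale sub *v ud y = (real q powi (int (card Basis) - int (d y)) / (real q - 1)) *\<^sub>R ud y
     + (real q powi (int (d y) - 1)) *\<^sub>R (\<Sum>z\<in>{z. cov y z}. ud z)" (is ?minus)
proof -
  show ?star
    by (simp only: vec_eq_iff vector_minus_component vector_scaleR_component sum_component
      Astar_mult updown_component scaleR_of_real flip: of_real_mult of_real_sum of_real_diff)
      (simp only: Astar_coef simp_thms)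
  show ?plus
    by (simp only: vec_eq_iff Aplus_def matrix_vector_mult_diff_rdistrib scaleR_matrix_vector_mult
      vector_minus_component vector_scaleR_component card_field
      matrix_inv_Astar_mult Rmat_mult updown_component scaleR_of_real
      flip: of_real_mult of_real_sum of_real_diff Aplus_coef) simp
  show ?minus
    by (simp only: vec_eq_iff Aminus_def matrix_vector_mult_add_rdistrib scaleR_matrix_vector_mult
      vector_add_component vector_scaleR_component card_field sum_component
      matrix_inv_Astar_mult Lmat_mult updown_component scaleR_of_real matrix_vector_mul_assoc[symmetric]
      flip: of_real_mult of_real_sum of_real_add Aminus_coef) simp
qed

text \<open>The coefficient \<open>(\<phi> - 1) / (q - 1)\<close> splits into the diagonal parts of
  the two matrices, and subtracting \<open>Aplus\<close> restores the sign of
  \<open>R\<close>.\<close>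

lemma Amat_eq: "Amat scale sub \<phi> = \<phi> *\<^sub>R Aminus scale sub - Aplus scale sub"
  by (simp add: Amat_def Aminus_def Aplus_def algebra_simps diff_divide_distrib)

end

theorem lemma15p12:
  fixes scale :: "'a::{field,finite} \<Rightarrow> 'v::ab_group_add \<Rightarrow> 'v"
    and sub :: "'x::finite \<Rightarrow> 'v set"
    and q N :: nat
    and \<phi> :: real
    and y :: 'x
  assumes "q = CARD('a)"
    and "vector_space scale"
    and "N \<ge> 1"
    and "vector_space.dim scale (UNIV :: 'v set) = N"
    and "bij_betw sub UNIV {S. module.subspace scale S}"
    and "\<phi> > 0"
  shows
    "Astar scale sub *v updown scale sub y =
       (real q powi (- int (sdim scale sub y))) *\<^sub>R updown scale sub y
       - ((real q - 1) * real q powi (- 2 * int (sdim scale sub y) - 1)) *\<^sub>R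
           (\<Sum>z\<in>{z. covers scale sub z y}. updown scale sub z)
     \<and> Aplus scale sub *v updown scale sub y =
       (real q ^ sdim scale sub y / (real q - 1)) *\<^sub>R updown scale sub y
     \<and> Aminus scale sub *v updown scale sub y =
       (real q powi (int N - int (sdim scale sub y)) / (real q - 1)) *\<^sub>R updown scale sub y
       + (real q powi (int (sdim scale sub y) - 1)) *\<^sub>R
           (\<Sum>z\<in>{z. covers scale sub y z}. updown scale sub z)
     \<and> Amat scale sub \<phi> *v updown scale sub y =
       ((\<phi> * real q powi (int N - int (sdim scale sub y)) - real q ^ sdim scale sub y)
          / (real q - 1)) *\<^sub>R updown scale sub y
       + (\<phi> * real q powi (int (sdim scale sub y) - 1)) *\<^sub>R
           (\<Sum>z\<in>{z. covers scale sub y z}. updown scale sub z)"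
proof -
  interpret V: vector_space scale by fact
  obtain B where B: "V.independent B" "UNIV \<subseteq> V.span B" "card B = V.dim UNIV"
    using V.basis_exists by blast
  \<comment> \<open>\<open>card\<close> of an infinite set is 0, so the positive dimension
    \<open>N\<close> forces finiteness.\<close>
  have "finite B"
    using B(3) assms(3,4) by (intro card_ge_0_finite) simp
  then interpret projective_geometry scale B q sub
    using B assms(1,5) by unfold_locales auto
  have N: "card B = N" using B(3) assms(4) by simp
  have sdim: "sdim scale sub y = d y" by (simp add: sdim_def)
  note ids = updown_identities[of y, unfolded N]
  have "Amat scale sub \<phi> *v ud y =
       ((\<phi> * real q powi (int N - int (d y)) - real q ^ d y) / (real q - 1)) *\<^sub>R ud y
       + (\<phi> * real q powi (int (d y) - 1)) *\<^sub>R (\<Sum>z\<in>{z. cov y z}. ud z)"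
    by (simp add: Amat_eq matrix_vector_mult_diff_rdistrib scaleR_matrix_vector_mult ids
      scaleR_add_right scaleR_diff_left diff_divide_distrib)
  then show ?thesis unfolding sdim using ids by blast
qed

end
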